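(* Let $X$ be a rack, let $k\ge m$ be positive integers with $k>1$, and let $\tau:\{1,\dots,k\}\to\{1,\dots,m\}$ be a surjection. Suppose that $X$ satisfies the $(\tau,k,m)$ inner identity $S$: $x\,y_{\tau(1)}\cdots y_{\tau(k)}=x$, i.e. this equality holds for all $x,y_1,\dots,y_m\in X$. Then the following hold. (i) For all $x,y_1,\dots,y_m\in X$, the $2$-chain $$L_S=L_S(x,y_1,\dots,y_m)=(x,y_{\tau(1)})+\sum_{i=1}^{k-1}\bigl(x\,y_{\tau(1)}\cdots y_{\tau(i)},\;y_{\tau(i+1)}\bigr)\in C_2(X)$$ is a rack $2$-cycle, i.e. $\partial_2(L_S)=0$. (ii) For every abelian group $A$ and every rack $2$-cocycle $\phi:X\times X\to A$, the abelian extension $E(X,A,\phi)$ satisfies the inner identity $S$ if and only if $\phi(L_S(x,y_1,\dots,y_m))=0$ for all $x,y_1,\dots,y_m\in X$. (iii) The subgroups $C^S_n(X)\subset C_n(X)$, $n\in\mathbb{Z}$, form a subcomplex of the rack chain complex $\{C_n(X),\partial_n\}$, i.e. $\partial_n(C_n^S(X))\subset C_{n-1}^S(X)$ for all $n$.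
   Context: A rack is a non-empty set $X$ with a binary operation $*$ such that (1) for every $b\in X$ the map $R_b:X\to X$, $R_b(a)=a*b$, is a bijection, and (2) $(a*b)*c=(a*c)*(b*c)$ for all $a,b,c\in X$. Products are written without $*$ and are left-associated: $x_1x_2\cdots x_k=(\cdots((x_1*x_2)*x_3)\cdots)*x_k$. A rack satisfies the inner identity $S$: $x\,y_{\tau(1)}\cdots y_{\tau(k)}=x$ if this equality holds for all elements $x,y_1,\dots,y_m$ of the rack. Rack chain complex: for $n\ge1$, $C_n(X)$ is the free abelian group on $n$-tuples $(x_1,\dots,x_n)\in X^n$, and $C_n(X)=0$ for $n\le 0$. The boundary is $\partial_n=\sum_{h=2}^n(-1)^h[d_h^{(n)}-\delta_h^{(n)}]$, where $d_h^{(n)}(x_1,\dots,x_n)=(x_1,\dots,\widehat{x_h},\dots,x_n)$ and $\delta_h^{(n)}(x_1,\dots,x_n)=(x_1*x_h,\dots,x_{h-1}*x_h,\widehat{x_h},x_{h+1},\dots,x_n)$ (hat means the entry is deleted). A rack $2$-cocycle with values in an abelian group $A$ is a function $\phi:X\times X\to A$ with $\phi(x,y)-\phi(x,z)+\phi(x*y,z)-\phi(x*z,y*z)=0$ for all $x,y,z\in X$; it is extended linearly to $C_2(X)$. The abelian extension $E(X,A,\phi)$ is the rack $X\times A$ with operation $(x,a)*(y,b)=(x*y,\,a+\phi(x,y))$. For a $(\tau,k,m)$ inner identity $S$: $x\,y_{\tau(1)}\cdots y_{\tau(k)}=x$, where $k\ge m$ are positive integers with $k>1$ and $\tau:\{1,\dots,k\}\to\{1,\dots,m\}$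 is a surjection, given $y_1,\dots,y_m\in X$ and $z\in X$, write $z\omega_i$ for the left-associated product $z\,y_{\tau(1)}\cdots y_{\tau(i)}$, $i\geq 1$. The subgroup $C^S_n(X)\subset C_n(X)$ is generated by all elements $$(x_1,\dots,x_j,y_{\tau(1)},x_{j+2},\dots,x_n)+\sum_{i=1}^{k-1}(x_1\omega_i,\dots,x_j\omega_i,y_{\tau(i+1)},x_{j+2},\dots,x_n),$$ where $1\le j\le n-1$, $x_h\in X$ for $h\in\{1,\dots,n\}\setminus\{j+1\}$, and $y_1,\dots,y_m\in X$ (so $C_n^S(X)=0$ for $n\le 1$). *)

theory Defs
  imports "HOL-Algebra.Free_Abelian_Groups"
begin

record 'a rack_struct = "'a partial_object" +
  rack_op :: "'a \<Rightarrow> 'a \<Rightarrow> 'a"  (infixl \<open>\<triangleright>\<index>\<close> 70)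

locale rack =
  fixes X (structure)
  assumes nonempty: "carrier X \<noteq> {}"
    and right_bij: "b \<in> carrier X \<Longrightarrow> bij_betw (\<lambda>a. a \<triangleright> b) (carrier X) (carrier X)"
    and right_distrib: "\<lbrakk>a \<in> carrier X; b \<in> carrier X; c \<in> carrier X\<rbrakk>
        \<Longrightarrow> (a \<triangleright> b) \<triangleright> c = (a \<triangleright> c) \<triangleright> (b \<triangleright> c)"

lemma (in rack) rack_op_closed [simp, intro]:
  "\<lbrakk>a \<in> carrier X; b \<in> carrier X\<rbrakk> \<Longrightarrow> a \<triangleright> b \<in> carrier X"
  using right_bij by (blast dest: bij_betwE)


section \<open>Inner identities\<close>

text \<open>The left-associated product \<open>z y\<^bsub>\<tau>(1)\<^esub> \<dots> y\<^bsub>\<tau>(i)\<^esub>\<close>, written \<open>z\<omega>\<^sub>i\<close> in the literature;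
  for \<open>i = 0\<close> it is \<open>z\<close>.\<close>

definition omega :: "('a, 'c) rack_struct_scheme \<Rightarrow> (nat \<Rightarrow> nat) \<Rightarrow> (nat \<Rightarrow> 'a) \<Rightarrow> 'a \<Rightarrow> nat \<Rightarrow> 'a"
  where "omega X \<tau> y z i = foldl (rack_op X) z (map (\<lambda>l. y (\<tau> l)) [1..<Suc i])"

definition satisfies_inner_identity ::
    "('a, 'c) rack_struct_scheme \<Rightarrow> (nat \<Rightarrow> nat) \<Rightarrow> nat \<Rightarrow> nat \<Rightarrow> bool"
  where "satisfies_inner_identity X \<tau> k m \<longleftrightarrow>
    (\<forall>x \<in> carrier X. \<forall>y \<in> {1..m} \<rightarrow> carrier X. omega X \<tau> y x k = x)"


section \<open>The rack chain complex\<close>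

text \<open>An \<open>n\<close>-tuple is a list of length \<open>n\<close>; there are deliberately no \<open>0\<close>-tuples, so that the
  chain group vanishes in every degree \<open>n \<le> 0\<close>.\<close>

definition rack_tuples :: "('a, 'c) rack_struct_scheme \<Rightarrow> int \<Rightarrow> 'a list set"
  where "rack_tuples X n = {xs. 1 \<le> n \<and> int (length xs) = n \<and> set xs \<subseteq> carrier X}"

definition rack_chain_group :: "('a, 'c) rack_struct_scheme \<Rightarrow> int \<Rightarrow> ('a list \<Rightarrow>\<^sub>0 int) monoid"
  where "rack_chain_group X n = free_Abelian_group (rack_tuples X n)"

text \<open>Entries are numbered from 1, so the entry \<open>x\<^sub>h\<close> of \<open>xs\<close> is \<open>xs ! (h - 1)\<close>.\<close>

definition face_d :: "nat \<Rightarrow> 'a list \<Rightarrow> 'a list"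
  where "face_d h xs = take (h - 1) xs @ drop h xs"

definition face_delta :: "('a, 'c) rack_struct_scheme \<Rightarrow> nat \<Rightarrow> 'a list \<Rightarrow> 'a list"
  where "face_delta X h xs =
    map (\<lambda>u. u \<triangleright>\<^bsub>X\<^esub> xs ! (h - 1)) (take (h - 1) xs) @ drop h xs"

definition rack_boundary ::
    "('a, 'c) rack_struct_scheme \<Rightarrow> int \<Rightarrow> ('a list \<Rightarrow>\<^sub>0 int) \<Rightarrow> ('a list \<Rightarrow>\<^sub>0 int)"
  where "rack_boundary X n = frag_extend (\<lambda>xs. \<Sum>h = 2..nat n.
    frag_cmul ((- 1) ^ h) (frag_of (face_d h xs) - frag_of (face_delta X h xs)))"

definition rack_cycle :: "('a, 'c) rack_struct_scheme \<Rightarrow> int \<Rightarrow> ('a list \<Rightarrow>\<^sub>0 int) \<Rightarrow> bool"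
  where "rack_cycle X n c \<longleftrightarrow> c \<in> carrier (rack_chain_group X n) \<and> rack_boundary X n c = 0"

lemma (in rack) rack_boundary_hom:
  "rack_boundary X n \<in> hom (rack_chain_group X n) (rack_chain_group X (n - 1))"
proof (rule homI)
  fix c assume c: "c \<in> carrier (rack_chain_group X n)"
  have face: "face_d h xs \<in> rack_tuples X (n - 1)" "face_delta X h xs \<in> rack_tuples X (n - 1)"
    if "xs \<in> rack_tuples X n" "h \<in> {2..nat n}" for xs h
  proof -
    have xs: "int (length xs) = n" "set xs \<subseteq> carrier X" and h: "2 \<le> h" "h \<le> length xs"
      using that by (auto simp: rack_tuples_def)
    have "set (take (h - 1) xs) \<subseteq> carrier X" "set (drop h xs) \<subseteq> carrier X"
      "xs ! (h - 1) \<in> carrier X"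
      using xs h set_take_subset[of "h - 1" xs] set_drop_subset[of h xs] nth_mem[of "h - 1" xs]
      by auto
    with xs h show "face_d h xs \<in> rack_tuples X (n - 1)" "face_delta X h xs \<in> rack_tuples X (n - 1)"
      by (auto simp: rack_tuples_def face_d_def face_delta_def)
  qed
  have "Poly_Mapping.keys (\<Sum>h = 2..nat n.
      frag_cmul ((- 1) ^ h) (frag_of (face_d h xs) - frag_of (face_delta X h xs)))
      \<subseteq> rack_tuples X (n - 1)" if "xs \<in> rack_tuples X n" for xs
  proof -
    have "frag_cmul ((- 1) ^ h) (frag_of (face_d h xs) - frag_of (face_delta X h xs))
        \<in> carrier (free_Abelian_group (rack_tuples X (n - 1)))" if "h \<in> {2..nat n}" for h
      using face[OF \<open>xs \<in> rack_tuples X n\<close> that]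
        keys_cmul[of "(- 1) ^ h" "frag_of (face_d h xs) - frag_of (face_delta X h xs)"]
        keys_diff[of "frag_of (face_d h xs)" "frag_of (face_delta X h xs)"]
      by (auto simp: keys_frag_of)
    then have "(\<Sum>h = 2..nat n.
        frag_cmul ((- 1) ^ h) (frag_of (face_d h xs) - frag_of (face_delta X h xs)))
        \<in> carrier (free_Abelian_group (rack_tuples X (n - 1)))"
      by (rule sum_closed_free_Abelian_group)
    then show ?thesis by simp
  qed
  with c show "rack_boundary X n c \<in> carrier (rack_chain_group X (n - 1))"
    unfolding rack_chain_group_def rack_boundary_def carrier_free_Abelian_group_iff
    by (blast dest: subsetD[OF keys_frag_extend])
next
  fix c d
  show "rack_boundary X n (c \<otimes>\<^bsub>rack_chain_group X n\<^esub> d)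
      = rack_boundary X n c \<otimes>\<^bsub>rack_chain_group X (n - 1)\<^esub> rack_boundary X n d"
    by (simp add: rack_chain_group_def rack_boundary_def frag_extend_add)
qed

definition subcomplex ::
    "(int \<Rightarrow> ('g, 'c) monoid_scheme) \<Rightarrow> (int \<Rightarrow> 'g \<Rightarrow> 'g) \<Rightarrow> (int \<Rightarrow> 'g set) \<Rightarrow> bool"
  where "subcomplex C bd D \<longleftrightarrow>
    (\<forall>n. subgroup (D n) (C n)) \<and> (\<forall>n. bd n ` D n \<subseteq> D (n - 1))"


section \<open>Cocycles and abelian extensions\<close>

text \<open>The coefficient group is an arbitrary commutative group in the sense of HOL-Algebra, so it
  is written multiplicatively.\<close>

definition rack_2_cocycle ::
    "('a, 'c) rack_struct_scheme \<Rightarrow> ('b, 'd) monoid_scheme \<Rightarrow> ('a \<times> 'a \<Rightarrow> 'b) \<Rightarrow> bool"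
  where "rack_2_cocycle X A \<phi> \<longleftrightarrow>
    \<phi> \<in> carrier X \<times> carrier X \<rightarrow> carrier A \<and>
    (\<forall>x \<in> carrier X. \<forall>y \<in> carrier X. \<forall>z \<in> carrier X.
      \<phi> (x, y) \<otimes>\<^bsub>A\<^esub> inv\<^bsub>A\<^esub> \<phi> (x, z) \<otimes>\<^bsub>A\<^esub> \<phi> (x \<triangleright>\<^bsub>X\<^esub> y, z)
        \<otimes>\<^bsub>A\<^esub> inv\<^bsub>A\<^esub> \<phi> (x \<triangleright>\<^bsub>X\<^esub> z, y \<triangleright>\<^bsub>X\<^esub> z) = \<one>\<^bsub>A\<^esub>)"

text \<open>The linear extension of \<open>\<phi>\<close> to \<open>2\<close>-chains.\<close>

definition cochain_eval ::
    "('b, 'd) monoid_scheme \<Rightarrow> ('a \<times> 'a \<Rightarrow> 'b) \<Rightarrow> ('a list \<Rightarrow>\<^sub>0 int) \<Rightarrow> 'b"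
  where "cochain_eval A \<phi> c =
    (\<Otimes>\<^bsub>A\<^esub>xs \<in> Poly_Mapping.keys c. \<phi> (xs ! 0, xs ! 1) [^]\<^bsub>A\<^esub> Poly_Mapping.lookup c xs)"

definition abelian_extension ::
    "('a, 'c) rack_struct_scheme \<Rightarrow> ('b, 'd) monoid_scheme \<Rightarrow> ('a \<times> 'a \<Rightarrow> 'b) \<Rightarrow> ('a \<times> 'b) rack_struct"
  where "abelian_extension X A \<phi> =
    \<lparr>carrier = carrier X \<times> carrier A,
     rack_op = (\<lambda>(x, a) (y, b). (x \<triangleright>\<^bsub>X\<^esub> y, a \<otimes>\<^bsub>A\<^esub> \<phi> (x, y)))\<rparr>"

lemma rack_abelian_extension:
  assumes "rack X" and "comm_group A" and \<phi>: "rack_2_cocycle X A \<phi>"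
  shows "rack (abelian_extension X A \<phi>)"
proof -
  interpret X: rack X by fact
  interpret A: comm_group A by fact
  have \<phi>_closed [simp, intro]: "\<phi> (x, y) \<in> carrier A" if "x \<in> carrier X" "y \<in> carrier X" for x y
    using \<phi> that by (auto simp: rack_2_cocycle_def)
  show ?thesis
  proof (unfold_locales)
    show "carrier (abelian_extension X A \<phi>) \<noteq> {}"
      using X.nonempty A.one_closed by (auto simp: abelian_extension_def)
  next
    fix q assume "q \<in> carrier (abelian_extension X A \<phi>)"
    then obtain y b where q: "q = (y, b)" and y: "y \<in> carrier X"
      by (auto simp: abelian_extension_def)
    have inj: "inj_on (\<lambda>x. x \<triangleright>\<^bsub>X\<^esub> y) (carrier X)"
      and img: "(\<lambda>x. x \<triangleright>\<^bsub>X\<^esub> y) ` carrier X = carrier X"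
      using X.right_bij[OF y] by (auto simp: bij_betw_def)
    have "inj_on (\<lambda>(x, a). (x \<triangleright>\<^bsub>X\<^esub> y, a \<otimes>\<^bsub>A\<^esub> \<phi> (x, y))) (carrier X \<times> carrier A)"
      using inj y by (auto simp: inj_on_def)
    moreover have "(\<lambda>(x, a). (x \<triangleright>\<^bsub>X\<^esub> y, a \<otimes>\<^bsub>A\<^esub> \<phi> (x, y))) ` (carrier X \<times> carrier A)
        = carrier X \<times> carrier A"
    proof
      show "carrier X \<times> carrier A
          \<subseteq> (\<lambda>(x, a). (x \<triangleright>\<^bsub>X\<^esub> y, a \<otimes>\<^bsub>A\<^esub> \<phi> (x, y))) ` (carrier X \<times> carrier A)"
      proof (clarify)
        fix x' a' assume x': "x' \<in> carrier X" and a': "a' \<in> carrier A"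
        then obtain x where x: "x \<in> carrier X" "x' = x \<triangleright>\<^bsub>X\<^esub> y" using img by blast
        have "(x', a') = (\<lambda>(x, a). (x \<triangleright>\<^bsub>X\<^esub> y, a \<otimes>\<^bsub>A\<^esub> \<phi> (x, y))) (x, a' \<otimes>\<^bsub>A\<^esub> inv\<^bsub>A\<^esub> \<phi> (x, y))"
          using x y a' by (simp add: A.m_assoc)
        moreover have "(x, a' \<otimes>\<^bsub>A\<^esub> inv\<^bsub>A\<^esub> \<phi> (x, y)) \<in> carrier X \<times> carrier A"
          using x y a' by simp
        ultimately show "(x', a') \<in> (\<lambda>(x, a). (x \<triangleright>\<^bsub>X\<^esub> y, a \<otimes>\<^bsub>A\<^esub> \<phi> (x, y))) ` (carrier X \<times> carrier A)"
          by (rule image_eqI)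
      qed
    qed (use y in auto)
    ultimately show "bij_betw (\<lambda>p. p \<triangleright>\<^bsub>abelian_extension X A \<phi>\<^esub> q)
        (carrier (abelian_extension X A \<phi>)) (carrier (abelian_extension X A \<phi>))"
      by (simp add: bij_betw_def abelian_extension_def q case_prod_unfold)
  next
    fix p q r
    assume "p \<in> carrier (abelian_extension X A \<phi>)" "q \<in> carrier (abelian_extension X A \<phi>)"
      "r \<in> carrier (abelian_extension X A \<phi>)"
    then obtain x a y b z c where eqs: "p = (x, a)" "q = (y, b)" "r = (z, c)"
      and mem: "x \<in> carrier X" "y \<in> carrier X" "z \<in> carrier X" "a \<in> carrier A"
      by (auto simp: abelian_extension_def)
    let ?s = "\<phi> (x, y)" and ?t = "\<phi> (x, z)" and ?u = "\<phi> (x \<triangleright>\<^bsub>X\<^esub> y, z)"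
      and ?v = "\<phi> (x \<triangleright>\<^bsub>X\<^esub> z, y \<triangleright>\<^bsub>X\<^esub> z)"
    have "(?s \<otimes>\<^bsub>A\<^esub> ?u) \<otimes>\<^bsub>A\<^esub> inv\<^bsub>A\<^esub> (?t \<otimes>\<^bsub>A\<^esub> ?v) = \<one>\<^bsub>A\<^esub>"
    proof -
      have "?s \<otimes>\<^bsub>A\<^esub> inv\<^bsub>A\<^esub> ?t \<otimes>\<^bsub>A\<^esub> ?u \<otimes>\<^bsub>A\<^esub> inv\<^bsub>A\<^esub> ?v = \<one>\<^bsub>A\<^esub>"
        using \<phi> mem unfolding rack_2_cocycle_def by blast
      then show ?thesis
        using mem by (simp add: A.inv_mult A.m_ac)
    qed
    then have "?s \<otimes>\<^bsub>A\<^esub> ?u = ?t \<otimes>\<^bsub>A\<^esub> ?v"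
      using mem A.inv_solve_right'[of "\<one>\<^bsub>A\<^esub>" "?s \<otimes>\<^bsub>A\<^esub> ?u" "?t \<otimes>\<^bsub>A\<^esub> ?v"] by simp
    moreover have "x \<triangleright>\<^bsub>X\<^esub> y \<triangleright>\<^bsub>X\<^esub> z = x \<triangleright>\<^bsub>X\<^esub> z \<triangleright>\<^bsub>X\<^esub> (y \<triangleright>\<^bsub>X\<^esub> z)"
      using mem X.right_distrib by blast
    ultimately show "p \<triangleright>\<^bsub>abelian_extension X A \<phi>\<^esub> q \<triangleright>\<^bsub>abelian_extension X A \<phi>\<^esub> r
        = p \<triangleright>\<^bsub>abelian_extension X A \<phi>\<^esub> r
          \<triangleright>\<^bsub>abelian_extension X A \<phi>\<^esub> (q \<triangleright>\<^bsub>abelian_extension X A \<phi>\<^esub> r)"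
      using mem by (simp add: abelian_extension_def eqs A.m_assoc)
  qed
qed


section \<open>Chains attached to an inner identity\<close>

definition L_S ::
    "('a, 'c) rack_struct_scheme \<Rightarrow> (nat \<Rightarrow> nat) \<Rightarrow> nat \<Rightarrow> 'a \<Rightarrow> (nat \<Rightarrow> 'a) \<Rightarrow> ('a list \<Rightarrow>\<^sub>0 int)"
  where "L_S X \<tau> k x y =
    frag_of [x, y (\<tau> 1)] + (\<Sum>i = 1..k - 1. frag_of [omega X \<tau> y x i, y (\<tau> (i + 1))])"

text \<open>In the generators below, \<open>us\<close> stands for \<open>(x\<^sub>1, \<dots>, x\<^sub>j)\<close>, of length \<open>j\<close>, and \<open>vs\<close> for the
  remaining entries \<open>(x\<^bsub>j+2\<^esub>, \<dots>, x\<^sub>n)\<close>, of length \<open>n - 1 - j\<close>.\<close>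

definition CS_element ::
    "('a, 'c) rack_struct_scheme \<Rightarrow> (nat \<Rightarrow> nat) \<Rightarrow> nat \<Rightarrow> 'a list \<Rightarrow> 'a list \<Rightarrow> (nat \<Rightarrow> 'a)
      \<Rightarrow> ('a list \<Rightarrow>\<^sub>0 int)"
  where "CS_element X \<tau> k us vs y =
    frag_of (us @ [y (\<tau> 1)] @ vs) +
    (\<Sum>i = 1..k - 1. frag_of (map (\<lambda>u. omega X \<tau> y u i) us @ [y (\<tau> (i + 1))] @ vs))"

definition CS_generators ::
    "('a, 'c) rack_struct_scheme \<Rightarrow> (nat \<Rightarrow> nat) \<Rightarrow> nat \<Rightarrow> nat \<Rightarrow> int \<Rightarrow> ('a list \<Rightarrow>\<^sub>0 int) set"
  where "CS_generators X \<tau> k m n = {CS_element X \<tau> k us vs y | j us vs y.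
    1 \<le> j \<and> j \<le> n - 1 \<and>
    int (length us) = j \<and> int (length vs) = n - 1 - j \<and>
    set us \<subseteq> carrier X \<and> set vs \<subseteq> carrier X \<and> y \<in> {1..m} \<rightarrow> carrier X}"

definition CS_group ::
    "('a, 'c) rack_struct_scheme \<Rightarrow> (nat \<Rightarrow> nat) \<Rightarrow> nat \<Rightarrow> nat \<Rightarrow> int \<Rightarrow> ('a list \<Rightarrow>\<^sub>0 int) set"
  where "CS_group X \<tau> k m n = generate (rack_chain_group X n) (CS_generators X \<tau> k m n)"

end

theory Submission
  imports Defs
begin

text \<open>Everything rests on the maps \<open>\<omega>\<^sub>i\<close> being compositions of right translations, hence rack
  endomorphisms, with \<open>(u\<omega>\<^sub>i) * v = (u * v)\<omega>'\<^sub>i\<close> where \<open>\<omega>'\<^sub>i\<close> is built from the elements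
  \<open>y\<^sub>l * v\<close>. Consequently deleting or acting by an entry before or after the distinguished entry
  sends a generator of \<open>C\<^sup>S\<^sub>n\<close> to a generator of \<open>C\<^sup>S\<^bsub>n-1\<^esub>\<close>. At the distinguished entry itself
  \<open>\<delta>\<close> of the \<open>i\<close>-th summand is \<open>d\<close> of the next one, so the sum telescopes and vanishes because
  \<open>\<omega>\<^sub>k\<close> is the identity. The cycle \<open>L\<^sub>S\<close> is the case \<open>n = 2\<close>, and in the abelian extension the
  second coordinate of \<open>(x, a)\<omega>\<^sub>k\<close> accumulates exactly \<open>\<phi>(L\<^sub>S)\<close>.\<close>

section \<open>Generators as uniform sums, and faces of concatenated tuples\<close>

lemma omega_0 [simp]: "omega X \<tau> y z 0 = z"
  by (simp add: omega_def)

lemma omega_Suc [simp]: "omega X \<tau> y z (Suc i) = omega X \<tau> y z i \<triangleright>\<^bsub>X\<^esub> y (\<tau> (Suc i))"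
  by (simp add: omega_def)

text \<open>Since \<open>omega\<close> at 0 is the identity, the isolated first term is the summand
  \<open>i = 0\<close>. The uniform range \<open>i < k\<close> is what makes the later telescoping
  possible.\<close>

lemma CS_element_eq_sum:
  assumes "1 \<le> k"
  shows "CS_element X \<tau> k us vs y
    = (\<Sum>i<k. frag_of (map (\<lambda>u. omega X \<tau> y u i) us @ y (\<tau> (Suc i)) # vs))"
proof -
  have "{..<k} = insert 0 {1..k - 1}"
    using assms by auto
  then show ?thesis
    by (simp add: CS_element_def)
qed

lemma L_S_eq_CS_element: "L_S X \<tau> k x y = CS_element X \<tau> k [x] [] y"
  by (simp add: L_S_def CS_element_def)

lemma face_d_append_before:
  assumes "h \<le> length us"
  shows "face_d h (us @ ws) = face_d h us @ ws"
  using assms by (simp add: face_d_def)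

lemma face_delta_append_before:
  assumes "1 \<le> h" "h \<le> length us"
  shows "face_delta X h (us @ ws) = face_delta X h us @ ws"
  using assms by (simp add: face_delta_def nth_append)

lemma face_d_append_at: "face_d (Suc (length us)) (us @ b # vs) = us @ vs"
  by (simp add: face_d_def)

lemma face_delta_append_at:
  "face_delta X (Suc (length us)) (us @ b # vs) = map (\<lambda>u. u \<triangleright>\<^bsub>X\<^esub> b) us @ vs"
  by (simp add: face_delta_def)

text \<open>The index \<open>h\<close> is zero-based in \<open>vs\<close>. The corresponding
  one-based position in the whole tuple is \<open>length us + 1 + (h + 1)\<close>, written with
  \<open>Suc\<close> to avoid truncated subtraction.\<close>

lemma face_d_append_after:
  "face_d (Suc (length us) + Suc h) (us @ b # vs) = us @ b # face_d (Suc h) vs"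
  by (simp add: face_d_def)

text \<open>The acting entry \<open>vs ! h\<close> stands to the right of \<open>b\<close>, so it
  moves \<open>b\<close> as well as \<open>us\<close>; this is what later forces a change of the
  family \<open>y\<close>.\<close>

lemma face_delta_append_after:
  "face_delta X (Suc (length us) + Suc h) (us @ b # vs)
    = map (\<lambda>u. u \<triangleright>\<^bsub>X\<^esub> vs ! h) us @ (b \<triangleright>\<^bsub>X\<^esub> vs ! h) # face_delta X (Suc h) vs"
  by (simp add: face_delta_def nth_append)

lemma length_face_d: "\<lbrakk>1 \<le> h; h \<le> length xs\<rbrakk> \<Longrightarrow> length (face_d h xs) = length xs - 1"
  by (auto simp: face_d_def)

lemma length_face_delta: "\<lbrakk>1 \<le> h; h \<le> length xs\<rbrakk> \<Longrightarrow> length (face_delta X h xs) = length xs - 1"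
  by (auto simp: face_delta_def)

lemma set_face_d: "set (face_d h xs) \<subseteq> set xs"
  by (auto simp: face_d_def dest: in_set_takeD in_set_dropD)

lemma (in rack) set_face_delta:
  assumes "1 \<le> h" "h \<le> length xs" "set xs \<subseteq> carrier X"
  shows "set (face_delta X h xs) \<subseteq> carrier X"
proof -
  have "xs ! (h - 1) \<in> carrier X"
    using assms by (auto simp: subset_iff)
  then show ?thesis
    using assms by (auto simp: face_delta_def dest: in_set_takeD in_set_dropD)
qed

lemma face_d_map: "face_d h (map f xs) = map f (face_d h xs)"
  by (simp add: face_d_def take_map drop_map)

section \<open>Right translations and their compositions\<close>

context rack
begin

lemma omega_closed:
  assumes "z \<in> carrier X" "\<forall>l \<in> {1..i}. y (\<tau> l) \<in> carrier X"
  shows "omega X \<tau> y z i \<in> carrier X"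
  using assms by (induction i) auto

text \<open>Self-distributivity says that each right translation is an endomorphism; a composition
  of endomorphisms is again one.\<close>

lemma omega_rack_op:
  assumes "u \<in> carrier X" "v \<in> carrier X" "\<forall>l \<in> {1..i}. y (\<tau> l) \<in> carrier X"
  shows "omega X \<tau> y (u \<triangleright> v) i = omega X \<tau> y u i \<triangleright> omega X \<tau> y v i"
  using assms
proof (induction i)
  case (Suc i)
  then have "omega X \<tau> y u i \<in> carrier X" "omega X \<tau> y v i \<in> carrier X" "y (\<tau> (Suc i)) \<in> carrier X"
    by (auto intro: omega_closed)
  with Suc show ?case
    using right_distrib[of "omega X \<tau> y u i" "omega X \<tau> y v i" "y (\<tau> (Suc i))"] by simp
qed simp

text \<open>Right translation by \<open>v\<close> is an endomorphism, so it distributes over the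
  left-associated product and acts on every factor.\<close>

lemma rack_op_omega:
  assumes "u \<in> carrier X" "v \<in> carrier X" "\<forall>l \<in> {1..i}. y (\<tau> l) \<in> carrier X"
  shows "omega X \<tau> y u i \<triangleright> v = omega X \<tau> (\<lambda>l. y l \<triangleright> v) (u \<triangleright> v) i"
  using assms
proof (induction i)
  case (Suc i)
  then have "omega X \<tau> y u i \<in> carrier X" "y (\<tau> (Suc i)) \<in> carrier X"
    by (auto intro: omega_closed)
  with Suc show ?case
    using right_distrib[of "omega X \<tau> y u i" "y (\<tau> (Suc i))" v] by simp
qed simp

text \<open>Here the acting entry lies in \<open>us\<close> and is itself moved by
  \<open>omega\<close>, so \<open>omega_rack_op\<close> applies and \<open>y\<close> stays the
  same.\<close>

lemma face_delta_map_omega: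
  assumes "1 \<le> h" "h \<le> length us" "set us \<subseteq> carrier X" "\<forall>l \<in> {1..i}. y (\<tau> l) \<in> carrier X"
  shows "face_delta X h (map (\<lambda>u. omega X \<tau> y u i) us)
    = map (\<lambda>u. omega X \<tau> y u i) (face_delta X h us)"
proof -
  have "us ! (h - 1) \<in> carrier X"
    using assms by (auto simp: subset_iff)
  then show ?thesis
    using assms
    by (auto simp: face_delta_def take_map drop_map omega_rack_op subset_iff dest: in_set_takeD)
qed

end

section \<open>The subgroups generated by an inner identity\<close>

locale inner_identity_rack = rack X for X (structure) +
  fixes \<tau> :: "nat \<Rightarrow> nat" and k m :: nat
  assumes k_pos: "1 \<le> k"
    and tau_image: "\<tau> ` {1..k} = {1..m}"
    and inner_identity: "satisfies_inner_identity X \<tau> k m"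
begin

lemma tau_mem: "l \<in> {1..k} \<Longrightarrow> \<tau> l \<in> {1..m}"
  using tau_image by blast

lemma y_tau_closed:
  assumes "y \<in> {1..m} \<rightarrow> carrier X" "i \<le> k"
  shows "\<forall>l \<in> {1..i}. y (\<tau> l) \<in> carrier X"
  using assms tau_mem by (auto simp: Pi_iff)

lemma omega_k:
  assumes "x \<in> carrier X" "y \<in> {1..m} \<rightarrow> carrier X"
  shows "omega X \<tau> y x k = x"
  using inner_identity assms by (auto simp: satisfies_inner_identity_def)

lemma CS_summand_mem_rack_tuples:
  assumes "set us \<subseteq> carrier X" "set vs \<subseteq> carrier X" "y \<in> {1..m} \<rightarrow> carrier X" "i < k"
    and "int (length us) + 1 + int (length vs) = n"
  shows "map (\<lambda>u. omega X \<tau> y u i) us @ y (\<tau> (Suc i)) # vs \<in> rack_tuples X n"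
proof -
  have "omega X \<tau> y u i \<in> carrier X" if "u \<in> set us" for u
    using assms that y_tau_closed[of y i] by (intro omega_closed) auto
  moreover have "y (\<tau> (Suc i)) \<in> carrier X"
    using y_tau_closed[OF assms(3), of "Suc i"] assms(4) by auto
  ultimately show ?thesis
    using assms by (auto simp: rack_tuples_def)
qed

lemma CS_element_closed:
  assumes "set us \<subseteq> carrier X" "set vs \<subseteq> carrier X" "y \<in> {1..m} \<rightarrow> carrier X"
    and "int (length us) + 1 + int (length vs) = n"
  shows "CS_element X \<tau> k us vs y \<in> carrier (rack_chain_group X n)"
  unfolding CS_element_eq_sum[OF k_pos] rack_chain_group_def
  by (rule sum_closed_free_Abelian_group) (use assms CS_summand_mem_rack_tuples in auto)

lemma CS_generators_subset: "CS_generators X \<tau> k m n \<subseteq> carrier (rack_chain_group X n)"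
  unfolding CS_generators_def by (clarify, rule CS_element_closed) auto

lemma subgroup_CS_group: "subgroup (CS_group X \<tau> k m n) (rack_chain_group X n)"
  unfolding CS_group_def
  by (rule group.generate_is_subgroup)
    (use CS_generators_subset in \<open>auto simp: rack_chain_group_def\<close>)

text \<open>With \<open>j = length us\<close>, the condition \<open>us \<noteq> []\<close> is
  \<open>1 \<le> j\<close>, and the length equation gives \<open>j \<le> n - 1\<close>.\<close>

lemma CS_element_mem_CS_group:
  assumes "us \<noteq> []" "set us \<subseteq> carrier X" "set vs \<subseteq> carrier X" "y \<in> {1..m} \<rightarrow> carrier X"
    and "int (length us) + 1 + int (length vs) = n"
  shows "CS_element X \<tau> k us vs y \<in> CS_group X \<tau> k m n"
proof -
  have "1 \<le> int (length us)"
    using assms(1) by (cases us) auto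
  then have "CS_element X \<tau> k us vs y \<in> CS_generators X \<tau> k m n"
    unfolding CS_generators_def using assms by fastforce
  then show ?thesis
    unfolding CS_group_def by (rule generate.incl)
qed

lemma CS_group_zero: "0 \<in> CS_group X \<tau> k m n"
  using subgroup.one_closed[OF subgroup_CS_group] by (simp add: rack_chain_group_def)

lemma CS_group_add:
  "\<lbrakk>a \<in> CS_group X \<tau> k m n; b \<in> CS_group X \<tau> k m n\<rbrakk> \<Longrightarrow> a + b \<in> CS_group X \<tau> k m n"
  using subgroup.m_closed[OF subgroup_CS_group] by (simp add: rack_chain_group_def)

lemma CS_group_minus:
  assumes "a \<in> CS_group X \<tau> k m n"
  shows "- a \<in> CS_group X \<tau> k m n"
proof -
  \<comment> \<open>The group inverse is identified with \<open>- a\<close> for elements of the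
    carrier.\<close>
  have "a \<in> carrier (rack_chain_group X n)"
    using assms subgroup.subset[OF subgroup_CS_group] by blast
  then show ?thesis
    using subgroup.m_inv_closed[OF subgroup_CS_group assms] by (simp add: rack_chain_group_def)
qed

lemma CS_group_diff:
  "\<lbrakk>a \<in> CS_group X \<tau> k m n; b \<in> CS_group X \<tau> k m n\<rbrakk> \<Longrightarrow> a - b \<in> CS_group X \<tau> k m n"
  using CS_group_add[OF _ CS_group_minus] by fastforce

lemma CS_group_cmul: "a \<in> CS_group X \<tau> k m n \<Longrightarrow> frag_cmul c a \<in> CS_group X \<tau> k m n"
  by (rule frag_closure_minus_cmul) (auto intro: CS_group_zero CS_group_diff)

lemma CS_group_sum: "(\<And>i. i \<in> I \<Longrightarrow> f i \<in> CS_group X \<tau> k m n) \<Longrightarrow> sum f I \<in> CS_group X \<tau> k m n"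
  by (induction I rule: infinite_finite_induct) (auto intro: CS_group_zero CS_group_add)

section \<open>The boundary of a generator, one face position at a time\<close>

lemma rack_boundary_CS_element:
  "rack_boundary X n (CS_element X \<tau> k us vs y) =
    (\<Sum>h = 2..nat n. frag_cmul ((- 1) ^ h)
      ((\<Sum>i<k. frag_of (face_d h (map (\<lambda>u. omega X \<tau> y u i) us @ y (\<tau> (Suc i)) # vs)))
      - (\<Sum>i<k. frag_of (face_delta X h (map (\<lambda>u. omega X \<tau> y u i) us @ y (\<tau> (Suc i)) # vs)))))"
  unfolding CS_element_eq_sum[OF k_pos] rack_boundary_def
  \<comment> \<open>Exchanging the sums over \<open>i\<close> and \<open>h\<close> collects all
    summands with the same face position. The two kinds of faces stay in separate sums, because away
    from the distinguished entry each sum is a generator by itself.\<close>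
  by (simp add: frag_extend_sum frag_cmul_sum flip: sum_subtractf) (rule sum.swap)

lemma face_before:
  assumes "1 \<le> h" "h \<le> length us" "set us \<subseteq> carrier X" "y \<in> {1..m} \<rightarrow> carrier X"
  shows "(\<Sum>i<k. frag_of (face_d h (map (\<lambda>u. omega X \<tau> y u i) us @ y (\<tau> (Suc i)) # vs)))
      = CS_element X \<tau> k (face_d h us) vs y" (is ?d)
    and "(\<Sum>i<k. frag_of (face_delta X h (map (\<lambda>u. omega X \<tau> y u i) us @ y (\<tau> (Suc i)) # vs)))
      = CS_element X \<tau> k (face_delta X h us) vs y" (is ?delta)
proof -
  show ?d
    using assms by (simp add: CS_element_eq_sum[OF k_pos] face_d_append_before face_d_map)
  show ?delta
    unfolding CS_element_eq_sum[OF k_pos]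
  proof (intro sum.cong refl arg_cong[where f = frag_of])
    fix i assume "i \<in> {..<k}"
    then show "face_delta X h (map (\<lambda>u. omega X \<tau> y u i) us @ y (\<tau> (Suc i)) # vs)
      = map (\<lambda>u. omega X \<tau> y u i) (face_delta X h us) @ y (\<tau> (Suc i)) # vs"
      using assms y_tau_closed[OF assms(4), of i]
      by (simp add: face_delta_append_before face_delta_map_omega)
  qed
qed

lemma face_at:
  assumes "set us \<subseteq> carrier X" "y \<in> {1..m} \<rightarrow> carrier X" and h: "h = Suc (length us)"
  shows "(\<Sum>i<k. frag_of (face_d h (map (\<lambda>u. omega X \<tau> y u i) us @ y (\<tau> (Suc i)) # vs)))
    - (\<Sum>i<k. frag_of (face_delta X h (map (\<lambda>u. omega X \<tau> y u i) us @ y (\<tau> (Suc i)) # vs))) = 0"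
proof -
  \<comment> \<open>\<open>g i\<close> is what remains of the \<open>i\<close>-th summand once its
    distinguished entry is deleted. Acting by that entry first performs the next multiplication in
    \<open>omega\<close>, which yields \<open>g (Suc i)\<close>.\<close>
  define g where "g i = frag_of (map (\<lambda>u. omega X \<tau> y u i) us @ vs)" for i
  have d: "frag_of (face_d h (map (\<lambda>u. omega X \<tau> y u i) us @ y (\<tau> (Suc i)) # vs)) = g i" for i
    using face_d_append_at[of "map (\<lambda>u. omega X \<tau> y u i) us"] by (simp add: g_def h)
  have delta: "frag_of (face_delta X h (map (\<lambda>u. omega X \<tau> y u i) us @ y (\<tau> (Suc i)) # vs))
      = g (Suc i)" for i
    using face_delta_append_at[of X "map (\<lambda>u. omega X \<tau> y u i) us"]
    by (simp add: g_def h comp_def)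
  \<comment> \<open>The inner identity closes the telescope: its two ends agree.\<close>
  have "map (\<lambda>u. omega X \<tau> y u k) us = us"
    using assms by (intro map_idI) (auto simp: omega_k)
  then have "g k = g 0"
    by (simp add: g_def)
  moreover have "(\<Sum>i<k. g i) - (\<Sum>i<k. g (Suc i)) = g 0 - g k"
    by (simp add: sum_lessThan_telescope' flip: sum_subtractf)
  ultimately show ?thesis
    by (simp add: d delta)
qed

text \<open>Deleting an entry of \<open>vs\<close> leaves \<open>us\<close> and \<open>y\<close>
  alone. Acting by it replaces \<open>y\<close> by its translate under \<open>vs ! q\<close>, which
  is again an admissible family, so the result is still a generator.\<close>

lemma face_after:
  assumes "set us \<subseteq> carrier X" "set vs \<subseteq> carrier X" "y \<in> {1..m} \<rightarrow> carrier X"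
    and "q < length vs" and h: "h = Suc (length us) + Suc q"
  shows "(\<Sum>i<k. frag_of (face_d h (map (\<lambda>u. omega X \<tau> y u i) us @ y (\<tau> (Suc i)) # vs)))
      = CS_element X \<tau> k us (face_d (Suc q) vs) y" (is ?d)
    and "(\<Sum>i<k. frag_of (face_delta X h (map (\<lambda>u. omega X \<tau> y u i) us @ y (\<tau> (Suc i)) # vs)))
      = CS_element X \<tau> k (map (\<lambda>u. u \<triangleright> vs ! q) us) (face_delta X (Suc q) vs) (\<lambda>l. y l \<triangleright> vs ! q)"
      (is ?delta)
proof -
  have v: "vs ! q \<in> carrier X"
    using assms by (auto simp: subset_iff)
  show ?d
    unfolding CS_element_eq_sum[OF k_pos]
    using face_d_append_after[of "map (\<lambda>u. omega X \<tau> y u _) us"] by (simp add: h)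
  show ?delta
    unfolding CS_element_eq_sum[OF k_pos]
  proof (intro sum.cong refl arg_cong[where f = frag_of])
    fix i assume "i \<in> {..<k}"
    then have "omega X \<tau> y u i \<triangleright> vs ! q = omega X \<tau> (\<lambda>l. y l \<triangleright> vs ! q) (u \<triangleright> vs ! q) i"
      if "u \<in> set us" for u
      using that assms v y_tau_closed[OF assms(3), of i] by (intro rack_op_omega) auto
    then show "face_delta X h (map (\<lambda>u. omega X \<tau> y u i) us @ y (\<tau> (Suc i)) # vs)
      = map (\<lambda>u. omega X \<tau> (\<lambda>l. y l \<triangleright> vs ! q) u i) (map (\<lambda>u. u \<triangleright> vs ! q) us)
        @ (y (\<tau> (Suc i)) \<triangleright> vs ! q) # face_delta X (Suc q) vs"
      using face_delta_append_after[of X "map (\<lambda>u. omega X \<tau> y u i) us" q] by (simp add: h)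
  qed
qed

lemma rack_boundary_CS_element_mem:
  assumes us: "us \<noteq> []" "set us \<subseteq> carrier X" and vs: "set vs \<subseteq> carrier X"
    and y: "y \<in> {1..m} \<rightarrow> carrier X" and n: "int (length us) + 1 + int (length vs) = n"
  shows "rack_boundary X n (CS_element X \<tau> k us vs y) \<in> CS_group X \<tau> k m (n - 1)"
  unfolding rack_boundary_CS_element
proof (intro CS_group_sum CS_group_cmul)
  fix h assume "h \<in> {2..nat n}"
  then have h: "2 \<le> h" "h \<le> length us + 1 + length vs"
    using n by auto
  consider "h \<le> length us" | "h = Suc (length us)" | q where "h = Suc (length us) + Suc q" "q < length vs"
  proof (cases "length us + 2 \<le> h")
    case True
    \<comment> \<open>The witness for \<open>q\<close> is the zero-based index in \<open>vs\<close>
      of the entry at one-based position \<open>h\<close>.\<close>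
    then have "h = Suc (length us) + Suc (h - length us - 2)" "h - length us - 2 < length vs"
      using h by linarith+
    then show thesis using that(3) by blast
  next
    case False
    then consider "h \<le> length us" | "h = Suc (length us)" by linarith
    then show thesis using that(1,2) by cases
  qed
  then show "(\<Sum>i<k. frag_of (face_d h (map (\<lambda>u. omega X \<tau> y u i) us @ y (\<tau> (Suc i)) # vs)))
    - (\<Sum>i<k. frag_of (face_delta X h (map (\<lambda>u. omega X \<tau> y u i) us @ y (\<tau> (Suc i)) # vs)))
    \<in> CS_group X \<tau> k m (n - 1)"
  proof cases
    case 1
    then have len: "length (face_d h us) = length us - 1" "length (face_delta X h us) = length us - 1"
      using h by (simp_all add: length_face_d length_face_delta)
    \<comment> \<open>The boundary starts at \<open>h = 2\<close>, so \<open>us\<close> has at least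
      two entries here, and losing one preserves the requirement \<open>1 \<le> j\<close>.\<close>
    then have "face_d h us \<noteq> []" "face_delta X h us \<noteq> []"
      using 1 h by (auto simp flip: length_greater_0_conv)
    then show ?thesis
      using 1 h us vs y n len set_face_d[of h us] set_face_delta[of h us]
      by (simp add: face_before) (intro CS_group_diff CS_element_mem_CS_group; auto)
  next
    case 2
    then show ?thesis
      using face_at[OF us(2) y] by (simp add: CS_group_zero)
  next
    case 3
    then have v: "vs ! q \<in> carrier X"
      using vs by (auto simp: subset_iff)
    have len: "length (face_d (Suc q) vs) = length vs - 1"
        "length (face_delta X (Suc q) vs) = length vs - 1"
      using 3 by (simp_all add: length_face_d length_face_delta)
    have "set (face_d (Suc q) vs) \<subseteq> carrier X" "set (face_delta X (Suc q) vs) \<subseteq> carrier X"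
      using set_face_d[of "Suc q" vs] set_face_delta[of "Suc q" vs] vs 3 by auto
    moreover have "set (map (\<lambda>u. u \<triangleright> vs ! q) us) \<subseteq> carrier X"
        "(\<lambda>l. y l \<triangleright> vs ! q) \<in> {1..m} \<rightarrow> carrier X"
      using us y v by auto
    ultimately show ?thesis
      unfolding face_after[OF us(2) vs y 3(2,1)]
      using 3 us y n len by (intro CS_group_diff CS_element_mem_CS_group) auto
  qed
qed

lemma rack_cycle_L_S:
  assumes x: "x \<in> carrier X" and y: "y \<in> {1..m} \<rightarrow> carrier X"
  shows "rack_cycle X 2 (L_S X \<tau> k x y)"
proof -
  have "rack_boundary X 2 (CS_element X \<tau> k [x] [] y) = 0"
    unfolding rack_boundary_CS_element
    \<comment> \<open>In degree 2 the only face position is \<open>h = 2\<close>, which is the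
      distinguished entry.\<close>
    using face_at[of "[x]" y 2 "[]"] x y by simp
  then show ?thesis
    using CS_element_closed[of "[x]" "[]" y 2] x y by (simp add: rack_cycle_def L_S_eq_CS_element)
qed

lemma rack_boundary_CS_group: "rack_boundary X n ` CS_group X \<tau> k m n \<subseteq> CS_group X \<tau> k m (n - 1)"
proof -
  interpret G: group_hom "rack_chain_group X n" "rack_chain_group X (n - 1)" "rack_boundary X n"
    unfolding group_hom_def group_hom_axioms_def
    using rack_boundary_hom by (simp add: rack_chain_group_def)
  have "rack_boundary X n ` CS_generators X \<tau> k m n \<subseteq> CS_group X \<tau> k m (n - 1)"
    unfolding CS_generators_def
    by (clarify, rule rack_boundary_CS_element_mem) auto
  then show ?thesis
    \<comment> \<open>The image of a generated subgroup under a homomorphism is generated by the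
      images of the generators, so the check on generators suffices.\<close>
    unfolding CS_group_def[of X \<tau> k m n] G.generate_img[OF CS_generators_subset, symmetric]
    by (intro G.H.generate_subgroup_incl subgroup_CS_group)
qed

end

section \<open>The linear extension of a cochain as a homomorphism\<close>

lemma hom_cochain_eval:
  assumes "comm_group A" and \<phi>: "\<And>xs. xs \<in> S \<Longrightarrow> \<phi> (xs ! 0, xs ! 1) \<in> carrier A"
  shows "cochain_eval A \<phi> \<in> hom (free_Abelian_group S) A"
proof -
  interpret A: comm_group A by fact
  let ?f = "\<lambda>c xs. \<phi> (xs ! 0, xs ! 1) [^]\<^bsub>A\<^esub> Poly_Mapping.lookup c xs"
  \<comment> \<open>Terms outside the support have exponent 0 and contribute \<open>\<one>\<close>.
    Thus \<open>c\<close>, \<open>d\<close> and \<open>c + d\<close> can be evaluated over one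
    common finite set, even if coefficients cancel in the sum.\<close>
  have eval: "cochain_eval A \<phi> c = finprod A (?f c) K"
    if "finite K" "Poly_Mapping.keys c \<subseteq> K" "K \<subseteq> S" for c K
    unfolding cochain_eval_def
    using that \<phi> by (intro A.finprod_mono_neutral_cong_left) (auto simp: not_in_keys_iff_lookup_eq_zero)
  show ?thesis
  proof (rule homI)
    fix c assume "c \<in> carrier (free_Abelian_group S)"
    then show "cochain_eval A \<phi> c \<in> carrier A"
      using \<phi> by (auto simp: cochain_eval_def intro!: A.finprod_closed)
  next
    fix c d assume "c \<in> carrier (free_Abelian_group S)" "d \<in> carrier (free_Abelian_group S)"
    then have S: "Poly_Mapping.keys c \<union> Poly_Mapping.keys d \<subseteq> S"
      by auto
    let ?K = "Poly_Mapping.keys c \<union> Poly_Mapping.keys d"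
    have "cochain_eval A \<phi> (c + d) = finprod A (?f (c + d)) ?K"
      using S keys_add[of c d] by (intro eval) auto
    also have "\<dots> = finprod A (\<lambda>xs. ?f c xs \<otimes>\<^bsub>A\<^esub> ?f d xs) ?K"
      using S \<phi> by (intro A.finprod_cong') (auto simp: lookup_add A.int_pow_mult subset_iff)
    also have "\<dots> = finprod A (?f c) ?K \<otimes>\<^bsub>A\<^esub> finprod A (?f d) ?K"
      using S \<phi> by (intro A.finprod_multf) auto
    also have "\<dots> = cochain_eval A \<phi> c \<otimes>\<^bsub>A\<^esub> cochain_eval A \<phi> d"
      using S by (simp add: eval[of ?K])
    finally show "cochain_eval A \<phi> (c \<otimes>\<^bsub>free_Abelian_group S\<^esub> d)
        = cochain_eval A \<phi> c \<otimes>\<^bsub>A\<^esub> cochain_eval A \<phi> d"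
      by simp
  qed
qed

lemma hom_cochain_eval_rack_chain_group:
  assumes "comm_group A" and \<phi>: "\<phi> \<in> carrier X \<times> carrier X \<rightarrow> carrier A"
  shows "cochain_eval A \<phi> \<in> hom (rack_chain_group X 2) A"
  unfolding rack_chain_group_def
proof (rule hom_cochain_eval[OF \<open>comm_group A\<close>])
  fix xs assume "xs \<in> rack_tuples X 2"
  then have "xs ! 0 \<in> set xs" "xs ! 1 \<in> set xs" and "set xs \<subseteq> carrier X"
    by (auto simp: rack_tuples_def intro!: nth_mem)
  then show "\<phi> (xs ! 0, xs ! 1) \<in> carrier A"
    using \<phi> by (auto simp: Pi_iff)
qed

lemma cochain_eval_frag_of:
  assumes "comm_group A" "\<phi> (x, y) \<in> carrier A"
  shows "cochain_eval A \<phi> (frag_of [x, y]) = \<phi> (x, y)"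
proof -
  interpret A: comm_group A by fact
  show ?thesis
    using assms(2) by (simp add: cochain_eval_def A.finprod_singleton_swap A.finprod_insert)
qed

section \<open>Inner identities in the abelian extension\<close>

context inner_identity_rack
begin

text \<open>The components \<open>snd \<circ> y\<close> do not enter the product, since the operation of the extension
  ignores the second coordinate of its right argument.\<close>

lemma omega_abelian_extension:
  assumes "comm_group A" and \<phi>: "\<phi> \<in> carrier X \<times> carrier X \<rightarrow> carrier A"
    and x: "x \<in> carrier X" and a: "a \<in> carrier A" and y: "fst \<circ> y \<in> {1..m} \<rightarrow> carrier X"
    and "i \<le> k"
  shows "omega (abelian_extension X A \<phi>) \<tau> y (x, a) i =
    (omega X \<tau> (fst \<circ> y) x i,
     a \<otimes>\<^bsub>A\<^esub> cochain_eval A \<phi> (\<Sum>l<i. frag_of [omega X \<tau> (fst \<circ> y) x l, fst (y (\<tau> (Suc l)))]))"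
  using \<open>i \<le> k\<close>
proof (induction i)
  case 0
  interpret A: comm_group A by fact
  show ?case
    using a by (simp add: cochain_eval_def)
next
  case (Suc i)
  interpret A: comm_group A by fact
  let ?z = "\<lambda>l. omega X \<tau> (fst \<circ> y) x l"
  let ?c = "\<Sum>l<i. frag_of [?z l, fst (y (\<tau> (Suc l)))]"
  note hom = hom_cochain_eval_rack_chain_group[OF \<open>comm_group A\<close> \<phi>]
  have mem: "[?z l, fst (y (\<tau> (Suc l)))] \<in> rack_tuples X 2" if "l < k" for l
    using CS_summand_mem_rack_tuples[of "[x]" "[]" "fst \<circ> y" l 2] x y that by simp
  have c: "?c \<in> carrier (rack_chain_group X 2)"
    unfolding rack_chain_group_def
    using mem Suc.prems by (intro sum_closed_free_Abelian_group) auto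
  have d: "frag_of [?z i, fst (y (\<tau> (Suc i)))] \<in> carrier (rack_chain_group X 2)"
    using mem Suc.prems by (simp add: rack_chain_group_def)
  have w: "\<phi> (?z i, fst (y (\<tau> (Suc i)))) \<in> carrier A"
    using \<phi> mem[of i] Suc.prems by (auto simp: rack_tuples_def)
  \<comment> \<open>The new summand evaluates to the factor that the next right multiplication puts
    on the second coordinate.\<close>
  have "cochain_eval A \<phi> (?c + frag_of [?z i, fst (y (\<tau> (Suc i)))])
      = cochain_eval A \<phi> ?c \<otimes>\<^bsub>A\<^esub> \<phi> (?z i, fst (y (\<tau> (Suc i))))"
    using hom_mult[OF hom c d] w
    by (simp add: rack_chain_group_def cochain_eval_frag_of[OF \<open>comm_group A\<close>])
  moreover have "cochain_eval A \<phi> ?c \<in> carrier A"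
    using hom_in_carrier[OF hom c] .
  ultimately show ?case
    using Suc a w by (simp add: abelian_extension_def case_prod_unfold A.m_assoc comp_def)
qed

text \<open>The full product fixes the first coordinate by the inner identity of \<open>X\<close>
  and multiplies the second by the value on \<open>L_S\<close>; it is the identity exactly when that
  value is always \<open>\<one>\<close>.\<close>

lemma inner_identity_abelian_extension_iff:
  assumes "comm_group A" and \<phi>: "\<phi> \<in> carrier X \<times> carrier X \<rightarrow> carrier A"
  shows "satisfies_inner_identity (abelian_extension X A \<phi>) \<tau> k m \<longleftrightarrow>
    (\<forall>x \<in> carrier X. \<forall>y \<in> {1..m} \<rightarrow> carrier X. cochain_eval A \<phi> (L_S X \<tau> k x y) = \<one>\<^bsub>A\<^esub>)"
    (is "?ext \<longleftrightarrow> ?vanish")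
proof -
  interpret A: comm_group A by fact
  have omega_k_ext: "omega (abelian_extension X A \<phi>) \<tau> y (x, a) k
      = (x, a \<otimes>\<^bsub>A\<^esub> cochain_eval A \<phi> (L_S X \<tau> k x (fst \<circ> y)))"
    if "x \<in> carrier X" "a \<in> carrier A" "fst \<circ> y \<in> {1..m} \<rightarrow> carrier X" for x a y
    using omega_abelian_extension[OF assms that, of k] that
    by (simp add: omega_k L_S_eq_CS_element CS_element_eq_sum[OF k_pos])
  have eval_closed: "cochain_eval A \<phi> (L_S X \<tau> k x y) \<in> carrier A"
    if "x \<in> carrier X" "y \<in> {1..m} \<rightarrow> carrier X" for x y
    using rack_cycle_L_S[OF that]
    by (auto simp: rack_cycle_def intro: hom_in_carrier[OF hom_cochain_eval_rack_chain_group[OF assms]])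
  show ?thesis
  proof
    assume ext: ?ext
    show ?vanish
    proof (intro ballI)
      fix x y assume x: "x \<in> carrier X" and y: "y \<in> {1..m} \<rightarrow> carrier X"
      \<comment> \<open>Lifting \<open>x\<close> and \<open>y\<close> with second coordinate
        \<open>\<one>\<close> makes the second coordinate of the product equal to the value on
        \<open>L_S\<close>.\<close>
      have comp: "fst \<circ> (\<lambda>l. (y l, \<one>\<^bsub>A\<^esub>)) = y"
        by auto
      have "omega (abelian_extension X A \<phi>) \<tau> (\<lambda>l. (y l, \<one>\<^bsub>A\<^esub>)) (x, \<one>\<^bsub>A\<^esub>) k = (x, \<one>\<^bsub>A\<^esub>)"
        using ext x y unfolding satisfies_inner_identity_def
        by (auto simp: abelian_extension_def Pi_iff)
      then show "cochain_eval A \<phi> (L_S X \<tau> k x y) = \<one>\<^bsub>A\<^esub>"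
        using omega_k_ext[of x "\<one>\<^bsub>A\<^esub>" "\<lambda>l. (y l, \<one>\<^bsub>A\<^esub>)"] x y eval_closed[OF x y]
        unfolding comp by simp
    qed
  next
    assume vanish: ?vanish
    show ?ext
      unfolding satisfies_inner_identity_def
    proof (intro ballI)
      fix p y assume "p \<in> carrier (abelian_extension X A \<phi>)"
        and y: "y \<in> {1..m} \<rightarrow> carrier (abelian_extension X A \<phi>)"
      then obtain x a where p: "p = (x, a)" "x \<in> carrier X" "a \<in> carrier A"
        by (auto simp: abelian_extension_def)
      have "fst \<circ> y \<in> {1..m} \<rightarrow> carrier X"
        using y by (auto simp: abelian_extension_def Pi_iff mem_Times_iff)
      then show "omega (abelian_extension X A \<phi>) \<tau> y p k = p"
        using omega_k_ext[of x a y] vanish p by simp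
    qed
  qed
qed

end

theorem theorem4p6:
  fixes X :: "'a rack_struct" and \<tau> :: "nat \<Rightarrow> nat" and k m :: nat
  assumes "rack X"
    and "1 \<le> m" and "m \<le> k" and "1 < k"
    and "\<tau> ` {1..k} = {1..m}"
    and "satisfies_inner_identity X \<tau> k m"
  shows "(\<forall>x \<in> carrier X. \<forall>y \<in> {1..m} \<rightarrow> carrier X. rack_cycle X 2 (L_S X \<tau> k x y))
    \<and> (\<forall>(A :: 'b monoid) \<phi>. comm_group A \<longrightarrow> rack_2_cocycle X A \<phi> \<longrightarrow>
         (satisfies_inner_identity (abelian_extension X A \<phi>) \<tau> k m \<longleftrightarrow>
          (\<forall>x \<in> carrier X. \<forall>y \<in> {1..m} \<rightarrow> carrier X. cochain_eval A \<phi> (L_S X \<tau> k x y) = \<one>\<^bsub>A\<^esub>)))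
    \<and> subcomplex (rack_chain_group X) (rack_boundary X) (CS_group X \<tau> k m)"
proof -
  interpret rack X by fact
  interpret inner_identity_rack X \<tau> k m
    by unfold_locales (use assms in auto)
  show ?thesis
    using rack_cycle_L_S inner_identity_abelian_extension_iff subgroup_CS_group
      rack_boundary_CS_group
    unfolding rack_2_cocycle_def subcomplex_def by blast
qed

end
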